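(* Let $T\in\mathbb R$, $T\neq0$. Then $B_{iT}$ does not belong to $\mathbf L_2(\mathscr S'_{\mathbb R},\mathcal C,P)$.
   Context: Hermite functions: $H_n(z)=(-1)^ne^{z^2}(d/dz)^ne^{-z^2}$ and $\zeta_n(z)=\frac{1}{\pi^{1/4}2^{n/2}(n!)^{1/2}}(-1)^ne^{-z^2/2}H_n(z)$, $n=0,1,\ldots$; these are entire functions, orthonormal in $L_2(\mathbb R,dx)$. For an entire function $h$, $\int_{[0,z]}h(u)\,du$ is the complex line integral along the segment from $0$ to $z$. White noise space: $\mathscr S'_{\mathbb R}$ is the space of real tempered distributions on $\mathbb R$, $\mathcal C$ its cylinder sigma-algebra, and $P$ the probability measure (Bochner–Minlos) with $\int e^{i\langle s,\omega\rangle}dP(\omega)=e^{-\|s\|_2^2/2}$ for all real Schwartz functions $s$. $Z_n(\omega)=\langle\zeta_n,\omega\rangle$, $n=0,1,\ldots$, are independent $N(0,1)$ random variables, in particular orthonormal in $\mathbf L_2(\mathscr S'_{\mathbb R},\mathcal C,P)$. For $z\in\mathbb C$, $B_z$ is the (a priori formal) series $B_z=\sum_{n=0}^\infty\left(\int_{[0,z]}\zeta_n(u)\,du\right)Z_n$. It belongs to $\mathbf L_2(\mathscr S'_{\mathbb R},\mathcal C,P)$ if and only if the series converges there, i.e. if and only if $\sum_{n=0}^\infty\left|\int_{[0,z]}\zeta_n(u)\,du\right|^2<\infty$. *)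

theory Defs
  imports "HOL-Probability.Probability" "HOL-Complex_Analysis.Complex_Analysis"
begin

definition hermite_H :: "nat \<Rightarrow> complex \<Rightarrow> complex" where
  "hermite_H n z = (-1) ^ n * exp (z\<^sup>2) * (deriv ^^ n) (\<lambda>w. exp (- (w\<^sup>2))) z"

definition hermite_fun :: "nat \<Rightarrow> complex \<Rightarrow> complex" where
  "hermite_fun n z =
     1 / complex_of_real (pi powr (1/4) * 2 powr (real n / 2) * (fact n) powr (1/2))
       * (-1) ^ n * exp (- (z\<^sup>2) / 2) * hermite_H n z"


definition schwartz_space :: "(real \<Rightarrow> real) set" where
  "schwartz_space =
     {s. (\<forall>k x. (deriv ^^ k) s field_differentiable at x) \<and>
         (\<forall>j k. bounded (range (\<lambda>x. x ^ j * (deriv ^^ k) s x)))}"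

definition schwartz_seminorm :: "nat \<Rightarrow> nat \<Rightarrow> (real \<Rightarrow> real) \<Rightarrow> real" where
  "schwartz_seminorm j k s = (SUP x. \<bar>x ^ j * (deriv ^^ k) s x\<bar>)"

definition schwartz_topology :: "(real \<Rightarrow> real) topology" where
  "schwartz_topology = topology_generated_by
     {{t \<in> schwartz_space. schwartz_seminorm j k (\<lambda>x. t x - s x) < e} | j k s e.
        s \<in> schwartz_space \<and> e > 0}"

text \<open>Functionals are total functions in HOL; \<^const>\<open>extensional\<close> fixes their values off
  the Schwartz space, so that distinct elements are distinct functionals.\<close>

definition tempered_distributions :: "((real \<Rightarrow> real) \<Rightarrow> real) set" where
  "tempered_distributions =
     {\<omega> \<in> extensional schwartz_space.
        (\<forall>s\<in>schwartz_space. \<forall>t\<in>schwartz_space. \<forall>a b.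
           \<omega> (\<lambda>x. a * s x + b * t x) = a * \<omega> s + b * \<omega> t) \<and>
        continuous_map schwartz_topology euclideanreal \<omega>}"

text \<open>The generators are the sets of all \<open>\<omega>\<close> whose values at finitely many Schwartz
  functions lie jointly in a Borel set; the finite set \<open>F\<close> itself serves as index set.\<close>

definition cylinder_algebra :: "((real \<Rightarrow> real) \<Rightarrow> real) measure" where
  "cylinder_algebra = sigma tempered_distributions
     {{\<omega> \<in> tempered_distributions. restrict \<omega> F \<in> A} | F A.
        finite F \<and> F \<subseteq> schwartz_space \<and> A \<in> sets (Pi\<^sub>M F (\<lambda>_. borel))}"

text \<open>By the Bochner-Minlos theorem exactly one measure has this property.\<close>

definition white_noise_measure :: "((real \<Rightarrow> real) \<Rightarrow> real) measure \<Rightarrow> bool" where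
  "white_noise_measure P \<longleftrightarrow>
     prob_space P \<and> sets P = sets cylinder_algebra \<and>
     (\<forall>s\<in>schwartz_space.
        (LINT \<omega>|P. exp (\<i> * complex_of_real (\<omega> s))) =
        complex_of_real (exp (- (LINT x|lborel. (s x)\<^sup>2) / 2)))"

text \<open>Hermite functions take real values on the real line, so \<^const>\<open>Re\<close> only
  changes the type here.\<close>

definition white_noise_Z :: "nat \<Rightarrow> ((real \<Rightarrow> real) \<Rightarrow> real) \<Rightarrow> real" where
  "white_noise_Z n \<omega> = \<omega> (\<lambda>x. Re (hermite_fun n (complex_of_real x)))"


definition L2_fun :: "'a measure \<Rightarrow> ('a \<Rightarrow> complex) set" where
  "L2_fun M = {f \<in> borel_measurable M. integrable M (\<lambda>\<omega>. (cmod (f \<omega>))\<^sup>2)}"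

definition L2_convergent_series :: "'a measure \<Rightarrow> (nat \<Rightarrow> 'a \<Rightarrow> complex) \<Rightarrow> bool" where
  "L2_convergent_series M X \<longleftrightarrow>
     (\<exists>f\<in>L2_fun M.
        (\<lambda>N. \<integral>\<^sup>+ \<omega>. ennreal ((cmod (f \<omega> - (\<Sum>n<N. X n \<omega>)))\<^sup>2) \<partial>M) \<longlonglongrightarrow> 0)"

text \<open>A priori \<open>B\<^sub>z\<close> is only a formal series, hence it is given by its sequence of terms.\<close>

definition B_series :: "complex \<Rightarrow> nat \<Rightarrow> ((real \<Rightarrow> real) \<Rightarrow> real) \<Rightarrow> complex" where
  "B_series z n \<omega> =
     contour_integral (linepath 0 z) (hermite_fun n) * complex_of_real (white_noise_Z n \<omega>)"

definition B_in_L2 :: "((real \<Rightarrow> real) \<Rightarrow> real) measure \<Rightarrow> complex \<Rightarrow> bool" where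
  "B_in_L2 P z \<longleftrightarrow> L2_convergent_series P (B_series z)"

end

theory Submission
  imports Defs
begin

text \<open>Convergence of the series in \<open>L\<^sub>2\<close> forces its terms to tend to \<open>0\<close> in \<open>L\<^sub>2\<close>, so no
  orthogonality is needed: it suffices that the coefficients \<open>a\<^sub>n\<close> do not tend to \<open>0\<close> and that
  the second moments of the \<open>Z\<^sub>n\<close> stay away from \<open>0\<close>. For the latter, \<open>x\<^sup>2 \<ge> 2 (1 - cos x)\<close> and
  the characteristic function give \<open>E Z\<^sub>n\<^sup>2 \<ge> 2 (1 - exp (-1/2))\<close>, since \<open>\<zeta>\<^sub>n\<close> has norm \<open>1\<close>. For
  the former, the first two terms of \<open>H\<^sub>n (i t)\<close> with \<open>n = 2 m\<close>, together with
  \<open>4 ^ m / (2 m) \<le> (2 m choose m)\<close>, show that \<open>\<bar>a\<^sub>n\<bar>\<^sup>2\<close> grows at least linearly in \<open>m\<close>.\<close>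

section \<open>Hermite polynomials and the closed form of the Hermite functions\<close>

text \<open>The recursion is what differentiating \<open>H_n(z) exp(-z^2)\<close> produces, up to
  sign. The polymorphic coefficients serve both the real line, for Schwartz membership and norms,
  and the imaginary axis.\<close>

primrec hermite_poly :: "nat \<Rightarrow> 'a::{idom} poly" where
  "hermite_poly 0 = 1"
| "hermite_poly (Suc n) = [:0, 2:] * hermite_poly n - pderiv (hermite_poly n)"

text \<open>Differentiating the recursion gives \<open>2 H_{n+1} + 2x H'_{n+1} - H''_{n+1}\<close>.
  By induction the last two terms are \<open>2(n+1)\<close> times \<open>2x H_n - H_n'\<close>,
  which is \<open>H_{n+1}\<close> again.\<close>

lemma pderiv_hermite_poly_Suc:
  "pderiv (hermite_poly (Suc n)) = smult (2 * of_nat (Suc n)) (hermite_poly n :: 'a::idom poly)"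
proof (induction n)
  case 0
  show ?case by (simp add: pderiv_pCons)
next
  case (Suc n)
  have "pderiv (hermite_poly (Suc (Suc n)) :: 'a poly) =
      smult 2 (hermite_poly (Suc n)) + [:0, 2:] * pderiv (hermite_poly (Suc n)) - pderiv (pderiv (hermite_poly (Suc n)))"
    by (simp only: hermite_poly.simps(2)[of "Suc n"] pderiv_diff pderiv_mult) (simp add: pderiv_pCons del: hermite_poly.simps(2))
  also have "\<dots> = smult 2 (hermite_poly (Suc n)) + smult (2 * of_nat (Suc n)) (hermite_poly (Suc n))"
    by (simp only: Suc.IH pderiv_smult) (simp add: algebra_simps smult_diff_right)
  also have "\<dots> = smult (2 * of_nat (Suc (Suc n))) (hermite_poly (Suc n))"
    by (simp only: smult_add_left[symmetric]) (simp add: algebra_simps)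
  finally show ?case .
qed

declare hermite_poly.simps(2) [simp del]

text \<open>Eliminating the derivative allows two-step inductions on values at a single
  point.\<close>

lemma poly_hermite_poly_Suc_Suc:
  "poly (hermite_poly (Suc (Suc n))) x =
     2 * x * poly (hermite_poly (Suc n)) x - 2 * of_nat (Suc n) * poly (hermite_poly n) (x::'a::idom)"
  by (subst hermite_poly.simps(2)) (simp only: pderiv_hermite_poly_Suc, simp)

lemma poly_hermite_poly_of_real:
  "poly (hermite_poly n) (of_real x) = (of_real (poly (hermite_poly n) x) :: 'a::{real_algebra_1,idom})"
proof (induction n rule: induct_nat_012)
  case 1
  show ?case by (simp add: hermite_poly.simps(2))
qed (simp_all add: poly_hermite_poly_Suc_Suc)

lemma higher_deriv_exp_minus_square:
  "(deriv ^^ n) (\<lambda>w. exp (- (w\<^sup>2))) = (\<lambda>w::complex. (-1) ^ n * poly (hermite_poly n) w * exp (- (w\<^sup>2)))"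
proof (induction n)
  case (Suc n)
  have "((\<lambda>w. (-1) ^ n * poly (hermite_poly n) w * exp (- (w\<^sup>2))) has_field_derivative
      (-1) ^ Suc n * poly (hermite_poly (Suc n)) z * exp (- (z\<^sup>2))) (at z)" for z :: complex
    by (rule derivative_eq_intros refl poly_DERIV | simp)+
      (simp add: hermite_poly.simps(2) algebra_simps)
  then show ?case
    by (auto simp: Suc.IH intro!: DERIV_imp_deriv)
qed simp

lemma hermite_H_eq_poly: "hermite_H n z = poly (hermite_poly n) z"
proof -
  have "hermite_H n z = ((-1) ^ n * (-1) ^ n) * (exp (z\<^sup>2) * exp (- (z\<^sup>2))) * poly (hermite_poly n) z"
    by (simp add: hermite_H_def higher_deriv_exp_minus_square)
  also have "\<dots> = poly (hermite_poly n) z"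
    by (simp only: mult_exp_exp power_mult_distrib[symmetric]) simp
  finally show ?thesis .
qed

definition hermite_norm :: "nat \<Rightarrow> real" where
  "hermite_norm n = pi powr (1/4) * 2 powr (real n / 2) * (fact n) powr (1/2)"

lemma hermite_norm_pos: "hermite_norm n > 0"
  by (simp add: hermite_norm_def)

lemma hermite_norm_square: "(hermite_norm n)\<^sup>2 = sqrt pi * 2 ^ n * fact n"
  by (simp add: hermite_norm_def power_mult_distrib powr_half_sqrt flip: powr_realpow powr_numeral)
    (simp add: powr_powr powr_half_sqrt powr_realpow)

lemma hermite_fun_eq_poly:
  "hermite_fun n z = (-1) ^ n / complex_of_real (hermite_norm n) * exp (- (z\<^sup>2) / 2) * poly (hermite_poly n) z"
  by (simp add: hermite_fun_def hermite_H_eq_poly hermite_norm_def)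

lemma Re_hermite_fun_of_real:
  "Re (hermite_fun n (complex_of_real x)) =
     poly (smult ((-1) ^ n / hermite_norm n) (hermite_poly n)) x * exp (- (x\<^sup>2) / 2)"
proof -
  have "hermite_fun n (complex_of_real x) =
     complex_of_real (poly (smult ((-1) ^ n / hermite_norm n) (hermite_poly n)) x * exp (- (x\<^sup>2) / 2))"
    by (simp add: hermite_fun_eq_poly poly_hermite_poly_of_real exp_of_real[symmetric])
  then show ?thesis by simp
qed

section \<open>Polynomials times Gaussians are Schwartz functions\<close>

lemma bounded_power_times_gaussian: "bounded (range (\<lambda>x::real. x ^ k * exp (- (x\<^sup>2) / 2)))"
proof -
  have "\<bar>x ^ k * exp (- (x\<^sup>2) / 2)\<bar> \<le> 1 + 2 ^ k * fact k" for x :: real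
  proof -
    \<comment> \<open>A single term of the exponential series is at most its sum;
      \<open>y = x^2/2\<close> then controls the even power \<open>x^(2k)\<close>, and
      \<open>1 + x^(2k)\<close> dominates \<open>x^k\<close> for either parity.\<close>
    have "y ^ k / fact k \<le> exp y" if "y \<ge> 0" for y :: real
      using that sum_le_suminf[OF summable_exp_generic[of y], of "{k}"]
      by (simp add: exp_def divide_inverse mult.commute)
    from this[of "x\<^sup>2 / 2"] have "(x\<^sup>2) ^ k \<le> 2 ^ k * fact k * exp (x\<^sup>2 / 2)"
      by (simp add: power_divide pos_divide_le_eq mult_ac)
    then have "x ^ (2*k) \<le> 2 ^ k * fact k * exp (x\<^sup>2 / 2)"
      by (simp only: power_mult)
    moreover have "\<bar>x ^ k\<bar> \<le> 1 + x ^ (2*k)"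
    proof -
      have "2 * \<bar>x ^ k\<bar> \<le> 1 + \<bar>x ^ k\<bar>\<^sup>2"
        using sum_squares_bound[of "1::real" "\<bar>x ^ k\<bar>"] by simp
      moreover have "\<bar>x ^ k\<bar>\<^sup>2 = x ^ (2*k)"
        by (simp add: power_even_eq)
      ultimately show ?thesis by linarith
    qed
    moreover have "1 \<le> exp (x\<^sup>2 / 2)" by simp
    ultimately have "\<bar>x ^ k\<bar> \<le> (1 + 2 ^ k * fact k) * exp (x\<^sup>2 / 2)"
      unfolding distrib_right by linarith
    then have "\<bar>x ^ k\<bar> / exp (x\<^sup>2 / 2) \<le> 1 + 2 ^ k * fact k"
      by (simp add: pos_divide_le_eq)
    moreover have "exp (- (x\<^sup>2) / 2) = inverse (exp (x\<^sup>2 / 2))"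
      by (simp flip: exp_minus)
    ultimately show ?thesis
      by (simp only: abs_mult abs_inverse abs_exp_cancel divide_inverse)
  qed
  then show ?thesis by (auto simp: bounded_iff)
qed

lemma bounded_poly_times_gaussian: "bounded (range (\<lambda>x::real. poly p x * exp (- (x\<^sup>2) / 2)))"
proof -
  have "\<exists>K. \<forall>i. \<forall>x::real. \<bar>x ^ i * exp (- (x\<^sup>2) / 2)\<bar> \<le> K i"
    using bounded_power_times_gaussian by (intro choice) (auto simp: bounded_iff)
  then obtain K where K: "\<And>i. \<And>x::real. \<bar>x ^ i * exp (- (x\<^sup>2) / 2)\<bar> \<le> K i" by blast
  have "\<bar>poly p x * exp (- (x\<^sup>2) / 2)\<bar> \<le> (\<Sum>i\<le>degree p. \<bar>coeff p i\<bar> * K i)" for x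
  proof -
    have "poly p x * exp (- (x\<^sup>2) / 2) = (\<Sum>i\<le>degree p. coeff p i * (x ^ i * exp (- (x\<^sup>2) / 2)))"
      by (simp add: poly_altdef sum_distrib_right mult.assoc)
    also have "\<bar>\<dots>\<bar> \<le> (\<Sum>i\<le>degree p. \<bar>coeff p i\<bar> * K i)"
      by (rule order.trans[OF sum_abs], rule sum_mono) (simp only: abs_mult[of "coeff p _"] mult_left_mono K abs_ge_zero)
    finally show ?thesis .
  qed
  then show ?thesis by (auto simp: bounded_iff)
qed

lemma integrable_poly_times_gaussian: "integrable lborel (\<lambda>x::real. poly p x * exp (- (x\<^sup>2) / 2))"
proof -
  \<comment> \<open>Moments of the normal law; \<open>sqrt (2 * pi)\<close> undoes the normalisation
    of its density.\<close>
  have "integrable lborel (\<lambda>x. sqrt (2 * pi) * (\<Sum>i\<le>degree p. coeff p i * (std_normal_density x * x ^ i)))"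
    by (intro Bochner_Integration.integrable_mult_right Bochner_Integration.integrable_sum integrable_std_normal_moment)
  then show ?thesis
    by (rule Bochner_Integration.integrable_cong[THEN iffD1, OF refl, rotated])
      (simp add: poly_altdef std_normal_density_def sum_distrib_left sum_distrib_right mult_ac)
qed

text \<open>Differentiation maps this class to itself by \<open>p |-> p' - x p\<close>, and so does
  multiplication by powers of \<open>x\<close>; hence boundedness of its members suffices.\<close>

lemma poly_times_gaussian_in_schwartz_space: "(\<lambda>x. poly p x * exp (- (x\<^sup>2) / 2)) \<in> schwartz_space"
proof -
  have D: "((\<lambda>x. poly p x * exp (- (x\<^sup>2) / 2)) has_field_derivative
      poly (pderiv p - [:0, 1:] * p) x * exp (- (x\<^sup>2) / 2)) (at x)" for p and x :: real
    by (rule derivative_eq_intros refl poly_DERIV | simp)+ (simp add: algebra_simps)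
  have "\<exists>q. (deriv ^^ k) (\<lambda>x. poly p x * exp (- (x\<^sup>2) / 2)) = (\<lambda>x. poly q x * exp (- (x\<^sup>2) / 2))" for k
  proof (induction k)
    case (Suc k)
    then obtain q where "(deriv ^^ k) (\<lambda>x. poly p x * exp (- (x\<^sup>2) / 2)) = (\<lambda>x. poly q x * exp (- (x\<^sup>2) / 2))"
      by blast
    moreover have "deriv (\<lambda>x. poly q x * exp (- (x\<^sup>2) / 2)) =
        (\<lambda>x. poly (pderiv q - [:0, 1:] * q) x * exp (- (x\<^sup>2) / 2))"
      by (intro ext DERIV_imp_deriv D)
    ultimately show ?case
      by (intro exI[of _ "pderiv q - [:0, 1:] * q"]) (simp only: funpow.simps o_apply)
  qed auto
  then have "\<exists>q. \<forall>k. (deriv ^^ k) (\<lambda>x. poly p x * exp (- (x\<^sup>2) / 2)) = (\<lambda>x. poly (q k) x * exp (- (x\<^sup>2) / 2))"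
    by (intro choice allI)
  then obtain q where q: "\<And>k. (deriv ^^ k) (\<lambda>x. poly p x * exp (- (x\<^sup>2) / 2)) = (\<lambda>x. poly (q k) x * exp (- (x\<^sup>2) / 2))"
    by blast
  have "bounded (range (\<lambda>x. x ^ j * (poly (q k) x * exp (- (x\<^sup>2) / 2))))" for j k
    using bounded_poly_times_gaussian[of "monom 1 j * q k"] by (simp add: poly_monom mult.assoc)
  moreover have "(\<lambda>x. poly (q k) x * exp (- (x\<^sup>2) / 2)) field_differentiable at x" for k x
    using D field_differentiable_def by blast
  ultimately show ?thesis unfolding schwartz_space_def mem_Collect_eq q by blast
qed

lemma hermite_fun_in_schwartz_space: "(\<lambda>x. Re (hermite_fun n (complex_of_real x))) \<in> schwartz_space"
  unfolding Re_hermite_fun_of_real by (rule poly_times_gaussian_in_schwartz_space)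

section \<open>The Hermite functions have norm 1\<close>

text \<open>The fundamental theorem of calculus on the whole line; it replaces integration by parts
  with vanishing boundary terms.\<close>

lemma lborel_integral_derivative_eq_0:
  fixes F f :: "real \<Rightarrow> real"
  assumes "\<And>x. (F has_real_derivative f x) (at x)" "\<And>x. isCont f x" "integrable lborel f"
    and "(F \<longlongrightarrow> 0) at_top" "(F \<longlongrightarrow> 0) at_bot"
  shows "(LINT x|lborel. f x) = 0"
proof -
  have "(LBINT x=-\<infinity>..\<infinity>. f x) = 0 - 0"
    by (rule interval_integral_FTC_integrable[where F = F])
      (use assms in \<open>auto simp: has_real_derivative_iff_has_vector_derivative[symmetric] ereal_tendsto_simps set_integrable_def\<close>)
  then show ?thesis
    by (simp add: interval_lebesgue_integral_def set_lebesgue_integral_def)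
qed

text \<open>One half of the exponent absorbs the polynomial; the other half remains as a majorant
  that is integrable and vanishes at infinity.\<close>

lemma poly_times_exp_minus_square_bound:
  obtains K where "K > 0" "\<And>x::real. \<bar>poly p x * exp (- (x\<^sup>2))\<bar> \<le> K * exp (- (x\<^sup>2) / 2)"
proof -
  obtain K where K: "K > 0" "\<And>x::real. \<bar>poly p x * exp (- (x\<^sup>2) / 2)\<bar> \<le> K"
    using bounded_poly_times_gaussian[of p] by (auto simp: bounded_pos)
  have "\<bar>poly p x * exp (- (x\<^sup>2))\<bar> \<le> K * exp (- (x\<^sup>2) / 2)" for x
  proof -
    have "exp (- (x\<^sup>2)) = exp (- (x\<^sup>2) / 2) * exp (- (x\<^sup>2) / 2)"
      by (simp add: mult_exp_exp)
    then show ?thesis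
      using mult_right_mono[OF K(2)[of x], of "exp (- (x\<^sup>2) / 2)"] by (simp add: abs_mult mult.assoc)
  qed
  with K(1) show ?thesis by (rule that)
qed

lemma integrable_poly_times_exp_minus_square: "integrable lborel (\<lambda>x::real. poly p x * exp (- (x\<^sup>2)))"
proof -
  obtain K where K: "\<And>x::real. \<bar>poly p x * exp (- (x\<^sup>2))\<bar> \<le> K * exp (- (x\<^sup>2) / 2)"
    using poly_times_exp_minus_square_bound by blast
  show ?thesis
  proof (rule Bochner_Integration.integrable_bound)
    show "integrable lborel (\<lambda>x::real. K * exp (- (x\<^sup>2) / 2))"
      using integrable_poly_times_gaussian[of "[:K:]"] by simp
    show "AE x in lborel. norm (poly p x * exp (- (x\<^sup>2))) \<le> norm (K * exp (- (x\<^sup>2) / 2))"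
      using K by (intro AE_I2) (auto intro: order.trans[OF _ abs_ge_self])
  qed (auto intro!: borel_measurable_continuous_onI continuous_intros)
qed

lemma tendsto_poly_times_exp_minus_square:
  "((\<lambda>x::real. poly p x * exp (- (x\<^sup>2))) \<longlongrightarrow> 0) at_top"
  "((\<lambda>x::real. poly p x * exp (- (x\<^sup>2))) \<longlongrightarrow> 0) at_bot"
proof -
  obtain K where K: "K > 0" "\<And>x::real. \<bar>poly p x * exp (- (x\<^sup>2))\<bar> \<le> K * exp (- (x\<^sup>2) / 2)"
    using poly_times_exp_minus_square_bound by blast
  have "((\<lambda>x::real. K * exp (- (x\<^sup>2) / 2)) \<longlongrightarrow> 0) at_top" "((\<lambda>x::real. K * exp (- (x\<^sup>2) / 2)) \<longlongrightarrow> 0) at_bot"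
    by real_asymp+
  with K(2) show "((\<lambda>x::real. poly p x * exp (- (x\<^sup>2))) \<longlongrightarrow> 0) at_top"
    "((\<lambda>x::real. poly p x * exp (- (x\<^sup>2))) \<longlongrightarrow> 0) at_bot"
    by (auto intro!: tendsto_rabs_zero_cancel elim!: Lim_null_comparison[rotated])
qed

lemma integral_hermite_poly_square:
  "(LINT x|lborel. (poly (hermite_poly n) x)\<^sup>2 * exp (- (x\<^sup>2))) = sqrt pi * 2 ^ n * fact n"
proof (induction n)
  case 0
  show ?case
    \<comment> \<open>\<open>gaussian_moment_0\<close> covers the half line; evenness doubles
      it.\<close>
    using gaussian_moment_0 has_bochner_integral_even_function[OF gaussian_moment_0]
    by (simp add: has_bochner_integral_integral_eq)
next
  case (Suc n)
  let ?h = "\<lambda>n x. poly (hermite_poly n) x"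
  let ?F = "\<lambda>x::real. poly (hermite_poly (Suc n) * hermite_poly n) x * exp (- (x\<^sup>2))"
  let ?A = "\<lambda>x::real. poly (smult (2 * real (Suc n)) ((hermite_poly n)\<^sup>2)) x * exp (- (x\<^sup>2))"
  let ?B = "\<lambda>x::real. poly ((hermite_poly (Suc n))\<^sup>2) x * exp (- (x\<^sup>2))"
  have I: "integrable lborel ?A" "integrable lborel ?B"
    by (rule integrable_poly_times_exp_minus_square)+
  \<comment> \<open>The integral of the derivative of \<open>H\<^sub>n\<^sub>+\<^sub>1 H\<^sub>n exp (-x\<^sup>2)\<close> vanishes.\<close>
  have "(?F has_real_derivative ?A x - ?B x) (at x)" for x
  proof -
    have "?h (Suc n) x = 2 * x * ?h n x - poly (pderiv (hermite_poly n)) x"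
      by (simp add: hermite_poly.simps(2))
    \<comment> \<open>Thus \<open>H_n' - 2x H_n\<close> is \<open>-H_{n+1}\<close>, while
      \<open>H_{n+1}'\<close> is \<open>2(n+1) H_n\<close>, so only the two squares in
      \<open>?A\<close> and \<open>?B\<close> survive.\<close>
    then have *: "poly (pderiv (hermite_poly n)) x = 2 * x * ?h n x - ?h (Suc n) x"
      by simp
    show ?thesis
      by (auto intro!: derivative_eq_intros simp: * pderiv_hermite_poly_Suc pderiv_mult power2_eq_square algebra_simps)
  qed
  then have "(LINT x|lborel. ?A x - ?B x) = 0"
    by (rule lborel_integral_derivative_eq_0)
      (use I in \<open>auto intro!: tendsto_poly_times_exp_minus_square continuous_intros simp del: poly_mult\<close>)
  then have "(LINT x|lborel. ?B x) = (LINT x|lborel. ?A x)"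
    using I by simp
  also have "\<dots> = 2 * real (Suc n) * (LINT x|lborel. (?h n x)\<^sup>2 * exp (- (x\<^sup>2)))"
    by (simp add: mult.assoc)
  finally show ?case
    by (simp add: Suc.IH)
qed

lemma integral_hermite_fun_square:
  "(LINT x|lborel. (Re (hermite_fun n (complex_of_real x)))\<^sup>2) = 1"
proof -
  have "(Re (hermite_fun n (complex_of_real x)))\<^sup>2 =
      1 / (hermite_norm n)\<^sup>2 * ((poly (hermite_poly n) x)\<^sup>2 * exp (- (x\<^sup>2)))" for x
  proof -
    have "(exp (- (x\<^sup>2) / 2))\<^sup>2 = exp (- (x\<^sup>2))"
      by (simp add: power2_eq_square mult_exp_exp)
    then show ?thesis
      by (simp add: Re_hermite_fun_of_real power_mult_distrib power_divide flip: power_mult)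
  qed
  then show ?thesis
    by (simp only: integral_mult_right_zero integral_hermite_poly_square hermite_norm_square) simp
qed

section \<open>Growth of the coefficients on the imaginary axis\<close>

text \<open>Here \<open>e m\<close> is the absolute value of \<open>H\<^sub>2\<^sub>m (0)\<close>. On the imaginary axis all terms of \<open>H\<^sub>n\<close> have
  the same phase, and the bounds keep only terms of lowest degree.\<close>

lemma hermite_poly_imaginary:
  fixes y :: real
  defines "e \<equiv> \<lambda>m. fact (2 * m) / fact m :: real"
  shows "\<exists>A B. poly (hermite_poly (2 * m)) (\<i> * complex_of_real y) = (-1) ^ m * complex_of_real A \<and>
     poly (hermite_poly (Suc (2 * m))) (\<i> * complex_of_real y) = (-1) ^ m * \<i> * complex_of_real (y * B) \<and>
     A \<ge> e m * (1 + 2 * real m * y\<^sup>2) \<and> B \<ge> 2 * (2 * real m + 1) * e m"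
proof (induction m)
  case 0
  show ?case
    by (rule exI[of _ 1], rule exI[of _ 2]) (simp add: hermite_poly.simps(2) e_def)
next
  case (Suc m)
  then obtain A B where AB:
    "poly (hermite_poly (2 * m)) (\<i> * complex_of_real y) = (-1) ^ m * complex_of_real A"
    "poly (hermite_poly (Suc (2 * m))) (\<i> * complex_of_real y) = (-1) ^ m * \<i> * complex_of_real (y * B)"
    "A \<ge> e m * (1 + 2 * real m * y\<^sup>2)" "B \<ge> 2 * (2 * real m + 1) * e m" by blast
  \<comment> \<open>At \<open>i y\<close> both terms of the three-term recurrence acquire the same
    sign, so nothing cancels. Splitting off the factor \<open>y\<close> of the odd polynomial keeps
    \<open>B\<close> positive for either sign of \<open>y\<close>.\<close>
  define A' where "A' = 2 * y\<^sup>2 * B + 2 * (2 * real m + 1) * A"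
  define B' where "B' = 2 * A' + 4 * (real m + 1) * B"
  have e: "e (Suc m) = 2 * (2 * real m + 1) * e m"
    by (simp add: e_def divide_simps) (simp add: algebra_simps)
  have 1: "poly (hermite_poly (Suc (Suc (2 * m)))) (\<i> * complex_of_real y) = (-1) ^ Suc m * complex_of_real A'"
    by (simp only: poly_hermite_poly_Suc_Suc AB A'_def)
      (simp add: algebra_simps power2_eq_square)
  have 2: "poly (hermite_poly (Suc (2 * Suc m))) (\<i> * complex_of_real y) = (-1) ^ Suc m * \<i> * complex_of_real (y * B')"
    by (simp only: mult_Suc_right add_2_eq_Suc poly_hermite_poly_Suc_Suc[of "Suc (2 * m)"] 1 AB B'_def)
      (simp add: algebra_simps)
  \<comment> \<open>As \<open>e (m+1) = 2(2m+1) e m\<close>, the bound on \<open>B\<close>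
    contributes \<open>2 y^2 e (m+1)\<close>, which raises the coefficient \<open>2m\<close> to
    \<open>2(m+1)\<close>.\<close>
  have "2 * y\<^sup>2 * (2 * (2 * real m + 1) * e m) + 2 * (2 * real m + 1) * (e m * (1 + 2 * real m * y\<^sup>2)) \<le> A'"
    unfolding A'_def by (intro add_mono mult_left_mono AB) auto
  then have 3: "e (Suc m) * (1 + 2 * real (Suc m) * y\<^sup>2) \<le> A'"
    by (simp add: e algebra_simps)
  moreover have "e (Suc m) \<le> e (Suc m) * (1 + 2 * real (Suc m) * y\<^sup>2)"
    using mult_left_mono[of 1 "1 + 2 * real (Suc m) * y\<^sup>2" "e (Suc m)"] by (simp add: e_def)
  ultimately have "2 * e (Suc m) + 4 * (real m + 1) * (2 * (2 * real m + 1) * e m) \<le> B'"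
    unfolding B'_def by (intro add_mono mult_left_mono AB) auto
  then have 4: "2 * (2 * real (Suc m) + 1) * e (Suc m) \<le> B'"
    by (simp add: e algebra_simps)
  show ?case using 1 2 3 4 by (metis mult_Suc_right add_2_eq_Suc)
qed

text \<open>With the constant phase removed, the integrand is real and at least
  \<open>c t^2\<close>. Squaring yields a factor \<open>m^2\<close>, of which the normalisation
  costs only one power of \<open>m\<close>.\<close>

lemma contour_integral_hermite_fun_imaginary:
  fixes T :: real
  assumes "m > 0"
  shows "(cmod (contour_integral (linepath 0 (\<i> * complex_of_real T)) (hermite_fun (2 * m))))\<^sup>2
    \<ge> 2 * T ^ 6 / (9 * sqrt pi) * real m"
\<comment> \<open>For \<open>T = 0\<close> the bound is \<open>0\<close>; otherwise division by
  \<open>?z\<close> is possible.\<close>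
proof (cases "T = 0")
  case False
  let ?f = "hermite_fun (2 * m)" and ?z = "\<i> * complex_of_real T"
  define I where "I = contour_integral (linepath 0 ?z) ?f"
  \<comment> \<open>The \<open>y^2\<close> term of the lower bound for \<open>H_{2m}\<close> at
    \<open>y = T t\<close>, normalised and with \<open>t^2\<close> split off.\<close>
  define c where "c = fact (2 * m) / fact m * (2 * real m * T\<^sup>2) / hermite_norm (2 * m)"
  have "?f contour_integrable_on linepath 0 ?z"
    unfolding hermite_fun_eq_poly[abs_def]
    by (intro contour_integrable_continuous_linepath continuous_intros) auto
  then have "(?f has_contour_integral I) (linepath 0 ?z)"
    unfolding I_def by (rule has_contour_integral_integral)
  \<comment> \<open>The factor \<open>(-1)^m / ?z\<close> cancels both the phase of the integrand
    and the derivative of the path.\<close>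
  then have J1: "((\<lambda>t. Re ((-1) ^ m / ?z * (?f (linepath 0 ?z t) * (?z - 0)))) has_integral Re ((-1) ^ m / ?z * I)) {0..1}"
    unfolding has_contour_integral_linepath by (intro has_integral_Re has_integral_mult_right)
  have J2: "((\<lambda>t. c * t\<^sup>2) has_integral c * (1 / 3)) {0..1}"
  proof -
    have "((\<lambda>t::real. t\<^sup>2) has_integral (1 ^ 3 / 3 - 0 ^ 3 / 3)) {0..1}"
      by (rule fundamental_theorem_of_calculus)
        (auto intro!: derivative_eq_intros simp: has_real_derivative_iff_has_vector_derivative[symmetric])
    then show ?thesis
      by (intro has_integral_mult_right) simp
  qed
  have J3: "c * t\<^sup>2 \<le> Re ((-1) ^ m / ?z * (?f (linepath 0 ?z t) * (?z - 0)))" for t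
  proof -
    let ?y = "T * t"
    obtain A where A: "poly (hermite_poly (2 * m)) (\<i> * complex_of_real ?y) = (-1) ^ m * complex_of_real A"
        "A \<ge> fact (2 * m) / fact m * (1 + 2 * real m * ?y\<^sup>2)"
      using hermite_poly_imaginary[of m ?y] by blast
    have "linepath 0 ?z t = \<i> * complex_of_real ?y"
      by (simp add: linepath_def scaleR_conv_of_real)
    moreover have "- ((\<i> * complex_of_real ?y)\<^sup>2) / 2 = complex_of_real (?y\<^sup>2 / 2)"
      by (simp add: power_mult_distrib)
    ultimately have "?f (linepath 0 ?z t) = (-1) ^ m * complex_of_real (exp (?y\<^sup>2 / 2) * A / hermite_norm (2 * m))"
      by (simp only: hermite_fun_eq_poly A exp_of_real) simp
    moreover have "(-1) ^ m / ?z * ((-1) ^ m * complex_of_real r * (?z - 0)) = complex_of_real r" for r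
      using False by (simp flip: power_mult_distrib)
    ultimately have *: "Re ((-1) ^ m / ?z * (?f (linepath 0 ?z t) * (?z - 0))) = exp (?y\<^sup>2 / 2) * A / hermite_norm (2 * m)"
      by (simp only: Re_complex_of_real)
    have "fact (2 * m) / fact m * (2 * real m * ?y\<^sup>2) \<le> fact (2 * m) / fact m * (1 + 2 * real m * ?y\<^sup>2)"
      by (intro mult_left_mono) auto
    also note A(2)
    finally have A': "fact (2 * m) / fact m * (2 * real m * ?y\<^sup>2) \<le> A" .
    then have "0 \<le> A" by (rule order.trans[rotated]) simp
    \<comment> \<open>On the imaginary axis the Gaussian factor is at least 1, so it may be
      dropped.\<close>
    then have "A \<le> exp (?y\<^sup>2 / 2) * A"
      by (simp add: mult_le_cancel_right1)
    with A' have "fact (2 * m) / fact m * (2 * real m * ?y\<^sup>2) / hermite_norm (2 * m) \<le> exp (?y\<^sup>2 / 2) * A / hermite_norm (2 * m)"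
      using hermite_norm_pos[of "2 * m"] by (intro divide_right_mono) auto
    then show ?thesis
      unfolding * by (simp add: c_def power_mult_distrib mult_ac)
  qed
  have "c * (1 / 3) \<le> Re ((-1) ^ m / ?z * I)"
    by (rule has_integral_le[OF J2 J1 J3])
  also have "\<dots> \<le> cmod ((-1) ^ m / ?z * I)"
    by (rule complex_Re_le_cmod)
  also have "\<dots> = cmod I / \<bar>T\<bar>"
    by (simp add: norm_mult norm_divide norm_power)
  finally have "c * \<bar>T\<bar> / 3 \<le> cmod I"
    using False by (simp add: field_simps)
  moreover have "c \<ge> 0"
    using hermite_norm_pos[of "2 * m"] by (simp add: c_def)
  ultimately have "(c * \<bar>T\<bar> / 3)\<^sup>2 \<le> (cmod I)\<^sup>2"
    by (intro power_mono) auto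
  \<comment> \<open>The right side equals \<open>4 m^2 T^6 / (9 sqrt pi)\<close> times
    \<open>(2m choose m) / 4^m\<close>, and the latter factor is at least
    \<open>1/(2m)\<close>.\<close>
  moreover have "2 * T ^ 6 / (9 * sqrt pi) * real m \<le> (c * \<bar>T\<bar> / 3)\<^sup>2"
  proof -
    have "real ((2 * m) choose m) = fact (2 * m) / (fact m * fact m)"
      by (subst binomial_fact) (auto simp: mult_2)
    then have "4 ^ m / (2 * real m) \<le> fact (2 * m) / (fact m * fact m)"
      using central_binomial_lower_bound[OF assms] by simp
    then have "1 / (2 * real m) \<le> fact (2 * m) / (fact m * fact m) / 4 ^ m"
      by (simp add: field_simps)
    then have "(4 * (real m)\<^sup>2 * T ^ 6 / (9 * sqrt pi)) * (1 / (2 * real m)) \<le>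
        (4 * (real m)\<^sup>2 * T ^ 6 / (9 * sqrt pi)) * (fact (2 * m) / (fact m * fact m) / 4 ^ m)"
      by (intro mult_left_mono) auto
    also have "\<dots> = (c * \<bar>T\<bar> / 3)\<^sup>2"
    proof -
      have "(c * \<bar>T\<bar> / 3)\<^sup>2 = (fact (2 * m) / fact m)\<^sup>2 * (2 * real m)\<^sup>2 * T ^ 6 / (9 * (hermite_norm (2 * m))\<^sup>2)"
        by (simp add: c_def power_mult_distrib power_divide flip: power_mult)
          (simp add: eval_nat_numeral)
      moreover have "(hermite_norm (2 * m))\<^sup>2 = sqrt pi * 4 ^ m * fact (2 * m)"
        by (simp add: hermite_norm_square power_mult)
      ultimately show ?thesis
        by (simp only:) (simp add: field_simps power2_eq_square)
    qed
    finally show ?thesis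
      using assms by (simp add: power2_eq_square)
  qed
  ultimately show ?thesis
    unfolding I_def by linarith
qed auto

section \<open>Evaluations on white noise space\<close>

lemma white_noise_evaluation_measurable:
  assumes "white_noise_measure P" "s \<in> schwartz_space"
  shows "(\<lambda>\<omega>. \<omega> s) \<in> borel_measurable P"
proof -
  have sets: "sets P = sets cylinder_algebra"
    using assms(1) by (simp add: white_noise_measure_def)
  have space: "space cylinder_algebra = tempered_distributions"
    by (simp add: cylinder_algebra_def space_measure_of_conv)
  have "(\<lambda>\<omega>. \<omega> s) -` B \<inter> tempered_distributions \<in> sets cylinder_algebra" if "B \<in> sets borel" for B
  proof -
    \<comment> \<open>The preimage of \<open>B\<close> is a generator of the cylinder algebra with
      the one-element index set \<open>{s}\<close>.\<close>
    let ?A = "{g \<in> space (Pi\<^sub>M {s} (\<lambda>_. borel)). g s \<in> B}"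
    have "?A \<in> sets (Pi\<^sub>M {s} (\<lambda>_. borel))"
      using that by measurable
    with assms(2) have "{\<omega> \<in> tempered_distributions. restrict \<omega> {s} \<in> ?A} \<in>
        {{\<omega> \<in> tempered_distributions. restrict \<omega> F \<in> A} | F A.
          finite F \<and> F \<subseteq> schwartz_space \<and> A \<in> sets (Pi\<^sub>M F (\<lambda>_. borel))}"
      by (intro CollectI exI[of _ "{s}"] exI[of _ ?A]) simp
    then have "{\<omega> \<in> tempered_distributions. restrict \<omega> {s} \<in> ?A} \<in> sets cylinder_algebra"
      unfolding cylinder_algebra_def by (rule in_measure_of[rotated]) blast
    moreover have "(\<lambda>\<omega>. \<omega> s) -` B \<inter> tempered_distributions = {\<omega> \<in> tempered_distributions. restrict \<omega> {s} \<in> ?A}"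
      by (auto simp: space_PiM)
    ultimately show ?thesis by simp
  qed
  then have "(\<lambda>\<omega>. \<omega> s) \<in> borel_measurable cylinder_algebra"
    by (auto intro!: measurableI simp: space)
  then show ?thesis
    by (simp cong: measurable_cong_sets add: sets)
qed

text \<open>The nonnegative integral has a meaning before the square is known to be
  integrable.\<close>

lemma white_noise_evaluation_second_moment_ge:
  assumes P: "white_noise_measure P" and s: "s \<in> schwartz_space" and norm: "(LINT x|lborel. (s x)\<^sup>2) = 1"
  shows "ennreal (2 * (1 - exp (- 1 / 2))) \<le> (\<integral>\<^sup>+ \<omega>. ennreal ((\<omega> s)\<^sup>2) \<partial>P)"
proof -
  interpret prob_space P using P by (simp add: white_noise_measure_def)
  note [measurable] = white_noise_evaluation_measurable[OF P s]
  have int: "integrable P (\<lambda>\<omega>. exp (\<i> * complex_of_real (\<omega> s)))"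
    by (rule integrable_const_bound[where B = 1]) auto
  then have int': "integrable P (\<lambda>\<omega>. cos (\<omega> s))"
    using integrable_Re[OF int] by (simp add: Re_exp)
  \<comment> \<open>The mean of the cosine is the real part of the characteristic functional at
    \<open>s\<close>.\<close>
  have "(LINT \<omega>|P. cos (\<omega> s)) = Re (LINT \<omega>|P. exp (\<i> * complex_of_real (\<omega> s)))"
    using integral_Re[OF int] by (simp add: Re_exp)
  also have "\<dots> = exp (- 1 / 2)"
    using P s norm by (simp add: white_noise_measure_def)
  finally have "(LINT \<omega>|P. 2 * (1 - cos (\<omega> s))) = 2 * (1 - exp (- 1 / 2))"
    using int' by (simp add: prob_space)
  then have "ennreal (2 * (1 - exp (- 1 / 2))) = (\<integral>\<^sup>+ \<omega>. ennreal (2 * (1 - cos (\<omega> s))) \<partial>P)"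
    using int' by (subst nn_integral_eq_integral) auto
  also have "\<dots> \<le> (\<integral>\<^sup>+ \<omega>. ennreal ((\<omega> s)\<^sup>2) \<partial>P)"
  proof (intro nn_integral_mono ennreal_leI)
    fix \<omega> :: "(real \<Rightarrow> real) \<Rightarrow> real"
    \<comment> \<open>The half-angle formula reduces the inequality to
      \<open>|sin x| <= |x|\<close>.\<close>
    have "1 - cos (\<omega> s) = 2 * (sin (\<omega> s / 2))\<^sup>2"
      using cos_double_sin[of "\<omega> s / 2"] by simp
    moreover have "(sin (\<omega> s / 2))\<^sup>2 \<le> (\<omega> s / 2)\<^sup>2"
      using abs_sin_x_le_abs_x[of "\<omega> s / 2"] by (simp add: abs_le_square_iff[symmetric])
    ultimately show "2 * (1 - cos (\<omega> s)) \<le> (\<omega> s)\<^sup>2"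
      by (simp add: power_divide)
  qed
  finally show ?thesis .
qed

section \<open>Terms of a convergent series, and the contradiction\<close>

text \<open>Each term is the difference of two consecutive remainders, and
  \<open>|a - b|^2 <= 2 |a|^2 + 2 |b|^2\<close>.\<close>

lemma L2_convergent_series_terms_tendsto_0:
  assumes X: "\<And>n. X n \<in> borel_measurable M" and conv: "L2_convergent_series M X"
  shows "(\<lambda>n. \<integral>\<^sup>+ \<omega>. ennreal ((cmod (X n \<omega>))\<^sup>2) \<partial>M) \<longlonglongrightarrow> 0"
proof -
  obtain f where f: "f \<in> borel_measurable M"
    and lim: "(\<lambda>N. \<integral>\<^sup>+ \<omega>. ennreal ((cmod (f \<omega> - (\<Sum>n<N. X n \<omega>)))\<^sup>2) \<partial>M) \<longlonglongrightarrow> 0"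
    using conv by (auto simp: L2_convergent_series_def L2_fun_def)
  note [measurable] = X f
  let ?r = "\<lambda>N \<omega>. f \<omega> - (\<Sum>n<N. X n \<omega>)"
  let ?d = "\<lambda>N. \<integral>\<^sup>+ \<omega>. ennreal ((cmod (?r N \<omega>))\<^sup>2) \<partial>M"
  have bound: "(\<integral>\<^sup>+ \<omega>. ennreal ((cmod (X n \<omega>))\<^sup>2) \<partial>M) \<le> 2 * ?d n + 2 * ?d (Suc n)" for n
  proof -
    have "(\<integral>\<^sup>+ \<omega>. ennreal ((cmod (X n \<omega>))\<^sup>2) \<partial>M) \<le>
        (\<integral>\<^sup>+ \<omega>. 2 * ennreal ((cmod (?r n \<omega>))\<^sup>2) + 2 * ennreal ((cmod (?r (Suc n) \<omega>))\<^sup>2) \<partial>M)"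
    proof (intro nn_integral_mono)
      fix \<omega>
      let ?a = "cmod (?r n \<omega>)" and ?b = "cmod (?r (Suc n) \<omega>)"
      have "cmod (X n \<omega>) \<le> ?a + ?b"
        using norm_triangle_ineq4[of "?r n \<omega>" "?r (Suc n) \<omega>"] by simp
      then have "(cmod (X n \<omega>))\<^sup>2 \<le> (?a + ?b)\<^sup>2"
        by (intro power_mono) auto
      also have "\<dots> \<le> 2 * ?a\<^sup>2 + 2 * ?b\<^sup>2"
        using sum_squares_bound[of ?a ?b] by (simp add: power2_sum)
      finally have "ennreal ((cmod (X n \<omega>))\<^sup>2) \<le> ennreal (2 * ?a\<^sup>2 + 2 * ?b\<^sup>2)"
        by (rule ennreal_leI)
      also have "\<dots> = ennreal (2 * ?a\<^sup>2) + ennreal (2 * ?b\<^sup>2)"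
        by (rule ennreal_plus) auto
      also have "\<dots> = 2 * ennreal (?a\<^sup>2) + 2 * ennreal (?b\<^sup>2)"
        by (simp only: ennreal_mult[OF zero_le_numeral zero_le_power2] ennreal_numeral)
      finally show "ennreal ((cmod (X n \<omega>))\<^sup>2) \<le> 2 * ennreal (?a\<^sup>2) + 2 * ennreal (?b\<^sup>2)" .
    qed
    also have "\<dots> = (\<integral>\<^sup>+ \<omega>. 2 * ennreal ((cmod (?r n \<omega>))\<^sup>2) \<partial>M) + (\<integral>\<^sup>+ \<omega>. 2 * ennreal ((cmod (?r (Suc n) \<omega>))\<^sup>2) \<partial>M)"
      by (rule nn_integral_add) measurable
    also have "\<dots> = 2 * ?d n + 2 * ?d (Suc n)"
      by (intro arg_cong2[where f = "(+)"] nn_integral_cmult) measurable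
    finally show ?thesis .
  qed
  have two: "(2::ennreal) < top" by simp
  have "(\<lambda>n. 2 * ?d n + 2 * ?d (Suc n)) \<longlonglongrightarrow> 2 * 0 + 2 * 0"
    by (rule tendsto_add[OF ennreal_tendsto_cmult[OF two lim] ennreal_tendsto_cmult[OF two LIMSEQ_Suc[OF lim]]])
  then have lim2: "(\<lambda>n. 2 * ?d n + 2 * ?d (Suc n)) \<longlonglongrightarrow> 0"
    by (simp only: mult_zero_right add_0_right)
  show ?thesis
    by (rule tendsto_sandwich[OF _ _ tendsto_const lim2]) (simp_all only: bound zero_le eventually_True)
qed

theorem theorem8p1:
  fixes T :: real and P :: "((real \<Rightarrow> real) \<Rightarrow> real) measure"
  assumes "white_noise_measure P"
    and "T \<noteq> 0"
  shows "\<not> B_in_L2 P (\<i> * complex_of_real T)"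
proof
  assume "B_in_L2 P (\<i> * complex_of_real T)"
  then have conv: "L2_convergent_series P (B_series (\<i> * complex_of_real T))"
    by (simp add: B_in_L2_def)
  let ?a = "\<lambda>n. contour_integral (linepath 0 (\<i> * complex_of_real T)) (hermite_fun n)"
  define \<kappa> where "\<kappa> = 2 * (1 - exp (- 1 / 2 :: real))"
  have "\<kappa> > 0" by (simp add: \<kappa>_def)
  have Z [measurable]: "white_noise_Z n \<in> borel_measurable P" for n
    using white_noise_evaluation_measurable[OF assms(1) hermite_fun_in_schwartz_space[of n]]
    by (simp add: white_noise_Z_def[abs_def])
  have "B_series (\<i> * complex_of_real T) n \<in> borel_measurable P" for n
    unfolding B_series_def[abs_def] by measurable
  then have lim: "(\<lambda>n. \<integral>\<^sup>+ \<omega>. ennreal ((cmod (B_series (\<i> * complex_of_real T) n \<omega>))\<^sup>2) \<partial>P) \<longlonglongrightarrow> 0"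
    using conv by (rule L2_convergent_series_terms_tendsto_0)
  have "ennreal ((cmod (?a n))\<^sup>2 * \<kappa>) \<le> (\<integral>\<^sup>+ \<omega>. ennreal ((cmod (B_series (\<i> * complex_of_real T) n \<omega>))\<^sup>2) \<partial>P)" for n
  proof -
    have "ennreal ((cmod (?a n))\<^sup>2 * \<kappa>) = ennreal ((cmod (?a n))\<^sup>2) * ennreal \<kappa>"
      by (simp add: ennreal_mult')
    also have "\<dots> \<le> ennreal ((cmod (?a n))\<^sup>2) * (\<integral>\<^sup>+ \<omega>. ennreal ((white_noise_Z n \<omega>)\<^sup>2) \<partial>P)"
      using white_noise_evaluation_second_moment_ge[OF assms(1) hermite_fun_in_schwartz_space integral_hermite_fun_square, of n]
      by (intro mult_left_mono) (simp_all add: \<kappa>_def white_noise_Z_def)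
    also have "\<dots> = (\<integral>\<^sup>+ \<omega>. ennreal ((cmod (B_series (\<i> * complex_of_real T) n \<omega>))\<^sup>2) \<partial>P)"
      by (subst nn_integral_cmult[symmetric])
        (simp_all add: B_series_def norm_mult power_mult_distrib ennreal_mult')
    finally show ?thesis .
  qed
  then have "(\<lambda>n. ennreal ((cmod (?a n))\<^sup>2 * \<kappa>)) \<longlonglongrightarrow> 0"
    by (intro tendsto_sandwich[OF _ _ tendsto_const lim]) auto
  then have "(\<lambda>n. (cmod (?a n))\<^sup>2 * \<kappa>) \<longlonglongrightarrow> 0"
    using \<open>\<kappa> > 0\<close> by (simp add: ennreal_tendsto_0_iff)
  then have "(\<lambda>n. (cmod (?a n))\<^sup>2) \<longlonglongrightarrow> 0"
    using \<open>\<kappa> > 0\<close> by (simp add: tendsto_mult_right_iff)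
  \<comment> \<open>Only even indices matter, since the growth bound concerns
    \<open>H_{2m}\<close>.\<close>
  then have lim0: "(\<lambda>m. (cmod (?a (2 * m)))\<^sup>2) \<longlonglongrightarrow> 0"
    by (rule LIMSEQ_subseq_LIMSEQ[of _ _ "\<lambda>m. 2 * m", unfolded o_def]) (simp add: strict_mono_def)
  have "filterlim (\<lambda>m. 2 * T ^ 6 / (9 * sqrt pi) * real m) at_top sequentially"
    using assms(2) by (intro filterlim_tendsto_pos_mult_at_top[OF tendsto_const] filterlim_real_sequentially) simp
  then have top0: "filterlim (\<lambda>m. (cmod (?a (2 * m)))\<^sup>2) at_top sequentially"
    by (rule filterlim_at_top_mono)
      \<comment> \<open>The growth bound assumes \<open>m > 0\<close>, hence the start at 1.\<close>
      (rule eventually_sequentiallyI[of 1], rule contour_integral_hermite_fun_imaginary, simp)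
  from not_tendsto_and_filterlim_at_infinity[OF _ lim0 filterlim_at_top_imp_at_infinity[OF top0]]
  show False by simp
qed

end
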